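(* Let $L\in\mathbb{Z}^d$, $L\neq\mathbf 0$, and let $p_n(x)=(1+\cos 2\pi\langle L,x\rangle)^n$ for $n\in\mathbb{N}$. Then $$\mathrm{UP}^{\mathbb{T}^d}_L(p_n)=\frac14+O\left(\frac1n\right),\qquad n\to\infty.$$
   Context: $\mathbb{T}^d=\mathbb{R}^d/\mathbb{Z}^d$; $\langle\cdot,\cdot\rangle$ and $\|\cdot\|$ on $\mathbb{R}^d$ are Euclidean; $\|f\|_{\mathbb{T}^d}$ and $\langle f,g\rangle=\int_{\mathbb{T}^d}f\overline g\,dx$ are the norm and inner product of $L_2(\mathbb{T}^d)$. For $L\in\mathbb{Z}^d\setminus\{\mathbf 0\}$ let $\mathcal{A}_Lf(x)=e^{2\pi i\langle L,x\rangle}f(x)$ and $\mathcal{B}_Lf(x)=\frac{i}{2\pi}\sum_{j=1}^dL_j\frac{\partial f}{\partial x_j}(x)$. The directional uncertainty product is $$\mathrm{UP}^{\mathbb{T}^d}_L(f)=\frac{1}{\|L\|^4}\left(\frac{\|f\|_{\mathbb{T}^d}^4}{|\langle\mathcal{A}_Lf,f\rangle|^2}-1\right)\left(\frac{\|\mathcal{B}_Lf\|_{\mathbb{T}^d}^2}{\|f\|_{\mathbb{T}^d}^2}-\frac{|\langle\mathcal{B}_Lf,f\rangle|^2}{\|f\|_{\mathbb{T}^d}^4}\right).$$ *)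

theory Defs
  imports "HOL-Analysis.Analysis" "HOL-Library.Landau_Symbols"
begin

text \<open>
  Functions on the torus \<open>\<real>\<^sup>d/\<int>\<^sup>d\<close> are represented by their 1-periodic lifts
  to \<open>\<real>\<^sup>d\<close>, and integrals over the torus by Lebesgue integrals over the unit cube
  (whose boundary is a null set, so using the closed cube makes no difference).
\<close>

definition torus_inner :: "(real ^ 'd \<Rightarrow> complex) \<Rightarrow> (real ^ 'd \<Rightarrow> complex) \<Rightarrow> complex" where
  "torus_inner f g = (LINT x : cbox 0 1 | lborel. f x * cnj (g x))"

definition torus_norm :: "(real ^ 'd \<Rightarrow> complex) \<Rightarrow> real" where
  "torus_norm f = sqrt (LINT x : cbox 0 1 | lborel. (cmod (f x))\<^sup>2)"

definition real_vec :: "int ^ 'd \<Rightarrow> real ^ 'd" where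
  "real_vec L = (\<chi> j. real_of_int (L $ j))"

definition partial_deriv :: "'d \<Rightarrow> (real ^ 'd \<Rightarrow> complex) \<Rightarrow> real ^ 'd \<Rightarrow> complex" where
  "partial_deriv j f x = vector_derivative (\<lambda>t. f (x + t *\<^sub>R axis j 1)) (at 0)"

definition A_op :: "int ^ 'd \<Rightarrow> (real ^ 'd \<Rightarrow> complex) \<Rightarrow> real ^ 'd \<Rightarrow> complex" where
  "A_op L f x = exp (2 * complex_of_real pi * \<i> * complex_of_real (real_vec L \<bullet> x)) * f x"

definition B_op :: "int ^ 'd \<Rightarrow> (real ^ 'd \<Rightarrow> complex) \<Rightarrow> real ^ 'd \<Rightarrow> complex" where
  "B_op L f x = \<i> / (2 * complex_of_real pi) * (\<Sum>j\<in>UNIV. of_int (L $ j) * partial_deriv j f x)"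

text \<open>
  The uncertainty product is meaningful only where the denominators are nonzero; elsewhere
  the convention \<open>a / 0 = 0\<close> applies.
\<close>

definition UP_torus :: "int ^ 'd \<Rightarrow> (real ^ 'd \<Rightarrow> complex) \<Rightarrow> real" where
  "UP_torus L f =
     1 / norm (real_vec L) ^ 4 *
     (torus_norm f ^ 4 / (cmod (torus_inner (A_op L f) f))\<^sup>2 - 1) *
     ((torus_norm (B_op L f))\<^sup>2 / (torus_norm f)\<^sup>2
        - (cmod (torus_inner (B_op L f) f))\<^sup>2 / torus_norm f ^ 4)"

definition p_poly :: "int ^ 'd \<Rightarrow> nat \<Rightarrow> real ^ 'd \<Rightarrow> complex" where
  "p_poly L n x = complex_of_real ((1 + cos (2 * pi * (real_vec L \<bullet> x))) ^ n)"

end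

theory Submission
  imports Defs
begin

text \<open>
  Writing \<open>I m\<close> for the integral of \<open>(1 + cos (2 * pi * (real_vec L \<bullet> x))) ^ m\<close> over the torus,
  every ingredient of the uncertainty product is a combination of \<open>I (2 * n - 1)\<close>, \<open>I (2 * n)\<close> and
  \<open>I (2 * n + 1)\<close>. Since the derivative of a periodic function of \<open>real_vec L \<bullet> x\<close> has integral zero,
  differentiating \<open>sin * (1 + cos) ^ m\<close> gives \<open>(m + 1) * I (m + 1) = (2 * m + 1) * I m\<close>,
  and all ratios become explicit: the uncertainty product equals \<open>1 / 4 + 1 / (2 * (4 * n - 1))\<close>.
\<close>

section \<open>Integration over the unit cube along one coordinate axis\<close>

text \<open>Lebesgue measure on \<open>real ^ 'd\<close> is the image of a product of
  one-dimensional Lebesgue measures indexed by \<open>Basis\<close>, so Fubini can split off the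
  factor belonging to \<open>axis j 1\<close>.\<close>

lemma lborel_integral_Fubini_axis:
  fixes g :: "real ^ 'd \<Rightarrow> real"
  assumes "integrable lborel g"
  shows "(LINT x|lborel. g x) =
    (LINT z|Pi\<^sub>M (Basis - {axis j 1}) (\<lambda>_. lborel).
      LINT y|lborel. g ((\<Sum>c\<in>Basis - {axis j 1}. z c *\<^sub>R c) + y *\<^sub>R axis j 1))"
proof -
  interpret product_sigma_finite "\<lambda>_::real ^ 'd. lborel :: real measure" ..
  define b where "b = (axis j 1 :: real ^ 'd)"
  define T where "T = (\<lambda>f::real ^ 'd \<Rightarrow> real. \<Sum>c\<in>Basis. f c *\<^sub>R c)"
  have b: "b \<in> Basis"
    by (simp add: b_def axis_in_Basis_iff)
  have ins: "insert b (Basis - {b}) = Basis"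
    using b by auto
  have lb: "lborel = distr (Pi\<^sub>M Basis (\<lambda>_. lborel)) borel T"
    unfolding T_def by (rule lborel_eq)
  have T[measurable]: "T \<in> Pi\<^sub>M Basis (\<lambda>_. lborel) \<rightarrow>\<^sub>M borel"
    unfolding T_def by measurable
  have g: "g \<in> borel_measurable borel"
    using assms by (simp add: integrable_iff_bounded)
  have int: "integrable (Pi\<^sub>M Basis (\<lambda>_. lborel)) (\<lambda>f. g (T f))"
    using assms integrable_distr_eq[OF T g] lb by simp
  have "(LINT x|lborel. g x) = (LINT f|Pi\<^sub>M Basis (\<lambda>_. lborel). g (T f))"
    using integral_distr[OF T g] lb by simp
  also have "\<dots> = (LINT z|Pi\<^sub>M (Basis - {b}) (\<lambda>_. lborel). LINT y|lborel. g (T (z(b := y))))"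
    using product_integral_insert[of "Basis - {b}" b "\<lambda>f. g (T f)"] int ins by simp
  also have "(\<lambda>z y. T (z(b := y))) = (\<lambda>z y. (\<Sum>c\<in>Basis - {b}. z c *\<^sub>R c) + y *\<^sub>R b)"
  proof (intro ext)
    fix z :: "real ^ 'd \<Rightarrow> real" and y :: real
    have "T (z(b := y)) = y *\<^sub>R b + (\<Sum>c\<in>Basis - {b}. (z(b := y)) c *\<^sub>R c)"
      unfolding T_def using b by (simp add: sum.remove)
    also have "(\<Sum>c\<in>Basis - {b}. (z(b := y)) c *\<^sub>R c) = (\<Sum>c\<in>Basis - {b}. z c *\<^sub>R c)"
      by (intro sum.cong) auto
    finally show "T (z(b := y)) = (\<Sum>c\<in>Basis - {b}. z c *\<^sub>R c) + y *\<^sub>R b"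
      by (simp only: add.commute)
  qed
  finally show ?thesis
    unfolding b_def .
qed

lemma set_integrable_cube:
  fixes g :: "real ^ 'd \<Rightarrow> 'a::{banach, second_countable_topology}"
  assumes "continuous_on UNIV g"
  shows "set_integrable lborel (cbox 0 1) g"
  unfolding set_integrable_def
  by (intro borel_integrable_compact compact_cbox continuous_on_subset[OF assms] subset_UNIV)

text \<open>Choose \<open>j\<close> with \<open>L $ j\<close> nonzero and integrate along that axis
  first. The antiderivative \<open>F (a + L $ j * y) / L $ j\<close> agrees at \<open>y = 0\<close>
  and \<open>y = 1\<close>, because \<open>L $ j\<close> is an integer and hence a period of
  \<open>F\<close>.\<close>

lemma LINT_cube_deriv_eq_0:
  fixes L :: "int ^ 'd" and F F' :: "real \<Rightarrow> real"
  assumes L: "L \<noteq> 0"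
    and deriv: "\<And>t. (F has_real_derivative F' t) (at t)"
    and cont: "continuous_on UNIV F'"
    and per: "\<And>t k. F (t + of_int k) = F t"
  shows "(LINT x : cbox 0 1 | lborel. F' (real_vec L \<bullet> x)) = 0"
proof -
  obtain j where j: "L $ j \<noteq> 0"
    using L by (auto simp: vec_eq_iff)
  define b where "b = (axis j 1 :: real ^ 'd)"
  have b: "b \<in> Basis"
    by (simp add: b_def axis_in_Basis_iff)
  have vb: "real_vec L \<bullet> b = of_int (L $ j)"
    by (simp add: b_def real_vec_def inner_axis)
  have "continuous_on UNIV (\<lambda>x. F' (real_vec L \<bullet> x))"
    by (intro continuous_on_compose2[OF cont] continuous_intros) auto
  note set_integrable_cube[OF this]
  note lborel_integral_Fubini_axis[OF this[unfolded set_integrable_def], of j]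
  moreover have "(LINT y|lborel. indicat_real (cbox 0 1) (u + y *\<^sub>R b) *\<^sub>R F' (real_vec L \<bullet> (u + y *\<^sub>R b))) = 0"
    if u: "u \<bullet> b = 0" for u
  proof -
    define a where "a = real_vec L \<bullet> u"
    \<comment> \<open>\<open>w\<close> tells whether the other coordinates lie in the unit interval.
      Since \<open>u \<bullet> b = 0\<close>, the remaining coordinate is \<open>y\<close> itself,
      so the indicator of the cube splits into \<open>w\<close> and that of
      \<open>{0..1}\<close>.\<close>
    define w :: real where "w = of_bool (\<forall>c\<in>Basis - {b}. 0 \<le> u \<bullet> c \<and> u \<bullet> c \<le> 1)"
    have bb: "b \<bullet> c = (if c = b then 1 else 0)" if "c \<in> Basis" for c
      using that b by (simp add: inner_Basis)
    have one: "(1 :: real ^ 'd) \<bullet> c = 1" if "c \<in> Basis" for c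
      using that by (auto simp: Basis_vec_def inner_axis)
    have "u + y *\<^sub>R b \<in> cbox 0 1 \<longleftrightarrow> y \<in> {0..1} \<and> (\<forall>c\<in>Basis - {b}. 0 \<le> u \<bullet> c \<and> u \<bullet> c \<le> 1)" for y
      using u b by (auto simp: mem_box inner_add_left bb one)
    then have ind: "indicat_real (cbox 0 1) (u + y *\<^sub>R b) = w * indicat_real {0..1} y" for y
      by (auto simp: indicator_def w_def)
    have "(LINT y|lborel. indicat_real {0..1} y *\<^sub>R F' (a + of_int (L $ j) * y)) =
        F (a + of_int (L $ j) * 1) / of_int (L $ j) - F (a + of_int (L $ j) * 0) / of_int (L $ j)"
    proof (rule integral_FTC_atLeastAtMost)
      fix y :: real
      have "((\<lambda>y. F (a + of_int (L $ j) * y) / of_int (L $ j)) has_real_derivative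
          F' (a + of_int (L $ j) * y)) (at y)"
        using j by (auto intro!: derivative_eq_intros DERIV_chain2[OF deriv])
      then show "((\<lambda>y. F (a + of_int (L $ j) * y) / of_int (L $ j)) has_vector_derivative
          F' (a + of_int (L $ j) * y)) (at y within {0..1})"
        by (simp add: has_real_derivative_iff_has_vector_derivative has_vector_derivative_at_within)
    next
      show "continuous_on {0..1} (\<lambda>y. F' (a + of_int (L $ j) * y))"
        by (intro continuous_on_compose2[OF cont] continuous_intros) auto
    qed simp
    also have "\<dots> = 0"
      using per[of a "L $ j"] by simp
    finally have "(LINT y|lborel. indicat_real {0..1} y * F' (a + of_int (L $ j) * y)) = 0"
      by simp
    then show ?thesis
      by (simp add: ind inner_add_right vb mult.assoc mult.commute[of _ "of_int (L $ j)"] flip: a_def)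
  qed
  \<comment> \<open>The base points in the outer integral have no component along \<open>b\<close>,
    so each inner integral vanishes.\<close>
  moreover have "(\<Sum>c\<in>Basis - {b}. z c *\<^sub>R c) \<bullet> b = 0" for z
    using b by (auto simp: inner_sum_left inner_Basis intro!: sum.neutral)
  ultimately show ?thesis
    unfolding set_lebesgue_integral_def b_def by simp
qed

section \<open>Moments of \<open>1 + cos\<close> on the torus\<close>

text \<open>This is \<open>I m\<close> of the overview. For nonzero \<open>L\<close> its value is
  the central binomial coefficient \<open>2 * m choose m\<close> divided by
  \<open>2 ^ m\<close>.\<close>

definition cos_moment :: "int ^ 'd \<Rightarrow> nat \<Rightarrow> real" where
  "cos_moment L m = (LINT x : cbox 0 1 | lborel. (1 + cos (2 * pi * (real_vec L \<bullet> x))) ^ m)"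

text \<open>Up to a constant factor the integrand is the derivative of
  \<open>(1 + cos) ^ Suc m\<close>. This removes the imaginary part of the inner product with
  \<open>A_op\<close> and the whole inner product with \<open>B_op\<close>.\<close>

lemma LINT_sin_cos_power:
  fixes L :: "int ^ 'd"
  assumes "L \<noteq> 0"
  shows "(LINT x : cbox 0 1 | lborel.
    sin (2 * pi * (real_vec L \<bullet> x)) * (1 + cos (2 * pi * (real_vec L \<bullet> x))) ^ m) = 0"
proof (rule LINT_cube_deriv_eq_0[OF assms])
  show "((\<lambda>t. - ((1 + cos (2 * pi * t)) ^ Suc m / (2 * pi * Suc m))) has_real_derivative
      sin (2 * pi * t) * (1 + cos (2 * pi * t)) ^ m) (at t)" for t
    by (rule derivative_eq_intros refl | simp)+
  show "continuous_on UNIV (\<lambda>t. sin (2 * pi * t) * (1 + cos (2 * pi * t)) ^ m)"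
    by (intro continuous_intros)
  show "- ((1 + cos (2 * pi * (t + of_int k))) ^ Suc m / (2 * pi * Suc m)) =
      - ((1 + cos (2 * pi * t)) ^ Suc m / (2 * pi * Suc m))" for t k
    by (simp add: ring_distribs cos_add)
qed

lemma set_integrable_cos_power:
  "set_integrable lborel (cbox 0 1) (\<lambda>x. (1 + cos (2 * pi * (real_vec L \<bullet> x))) ^ m)"
  by (intro set_integrable_cube continuous_intros)

lemma cos_moment_Suc:
  fixes L :: "int ^ 'd"
  assumes "L \<noteq> 0"
  shows "(real m + 1) * cos_moment L (Suc m) = (2 * real m + 1) * cos_moment L m"
proof -
  let ?c = "\<lambda>t. 1 + cos (2 * pi * t)"
  have "(LINT x : cbox 0 1 | lborel. (real m + 1) * ?c (real_vec L \<bullet> x) ^ Suc m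
      - (2 * real m + 1) * ?c (real_vec L \<bullet> x) ^ m) = 0"
  proof (rule LINT_cube_deriv_eq_0[OF assms])
    fix t :: real
    \<comment> \<open>The factorisation of \<open>sin^2\<close> as
      \<open>(1 - cos) * (1 + cos)\<close> restores the power lost by differentiating. For
      \<open>m = 0\<close>, where \<open>m - 1\<close> truncates, the factor \<open>real m\<close>
      makes both sides zero.\<close>
    have "sin (2 * pi * t) * (real m * ?c t ^ (m - 1) * sin (2 * pi * t)) =
        real m * (1 - cos (2 * pi * t)) * ?c t ^ m"
    proof (cases m)
      case (Suc k)
      have "sin (2 * pi * t) * sin (2 * pi * t) = (1 - cos (2 * pi * t)) * ?c t"
        using sin_cos_squared_add[of "2 * pi * t"] by (simp add: power2_eq_square algebra_simps)
      then show ?thesis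
        by (simp add: Suc)
    qed simp
    then have *: "cos (2 * pi * t) * ?c t ^ m - sin (2 * pi * t) * (real m * ?c t ^ (m - 1) * sin (2 * pi * t))
       = (real m + 1) * ?c t ^ Suc m - (2 * real m + 1) * ?c t ^ m"
      by (simp add: algebra_simps)
    show "((\<lambda>t. sin (2 * pi * t) * ?c t ^ m / (2 * pi)) has_real_derivative
        (real m + 1) * ?c t ^ Suc m - (2 * real m + 1) * ?c t ^ m) (at t)"
      unfolding *[symmetric]
      by (rule derivative_eq_intros refl | simp add: field_simps)+
    show "sin (2 * pi * (t + of_int k)) * ?c (t + of_int k) ^ m / (2 * pi) =
        sin (2 * pi * t) * ?c t ^ m / (2 * pi)" for k
      by (simp add: ring_distribs cos_add sin_add)
  qed (intro continuous_intros)
  also have "(LINT x : cbox 0 1 | lborel. (real m + 1) * ?c (real_vec L \<bullet> x) ^ Suc m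
      - (2 * real m + 1) * ?c (real_vec L \<bullet> x) ^ m) =
      (real m + 1) * cos_moment L (Suc m) - (2 * real m + 1) * cos_moment L m"
    unfolding cos_moment_def
    by (subst set_integral_diff)
      (auto intro!: set_integrable_mult_right set_integrable_cos_power simp del: power_Suc)
  finally show ?thesis
    by simp
qed

text \<open>The recurrence has positive coefficients and starts from the volume 1 of the cube.
  Positivity permits division by moments later.\<close>

lemma cos_moment_pos:
  fixes L :: "int ^ 'd"
  assumes "L \<noteq> 0"
  shows "cos_moment L m > 0"
proof (induction m)
  case 0
  have "(\<Prod>b\<in>(Basis :: (real ^ 'd) set). 1 \<bullet> b) = (1::real)"
    by (intro prod.neutral) (auto simp: Basis_vec_def inner_axis)
  moreover have "(0::real ^ 'd) \<bullet> b \<le> 1 \<bullet> b" if "b \<in> Basis" for b :: "real ^ 'd"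
    using that by (auto simp: Basis_vec_def inner_axis)
  ultimately have "measure lborel (cbox 0 (1 :: real ^ 'd)) = 1"
    by (subst measure_lborel_cbox_eq) auto
  then show ?case
    by (simp add: cos_moment_def set_lebesgue_integral_def)
next
  case (Suc m)
  have "0 < (2 * real m + 1) * cos_moment L m"
    using Suc by simp
  then have "0 < (real m + 1) * cos_moment L (Suc m)"
    by (simp only: cos_moment_Suc[OF assms])
  then show ?case
    by (simp add: zero_less_mult_iff)
qed

section \<open>Norms and inner products in terms of moments\<close>

lemma torus_norm_p_poly: "(torus_norm (p_poly L n))\<^sup>2 = cos_moment L (2 * n)"
proof -
  have "(cmod (p_poly L n x))\<^sup>2 = (1 + cos (2 * pi * (real_vec L \<bullet> x))) ^ (2 * n)" for x
    unfolding p_poly_def norm_of_real power2_abs by (simp add: mult.commute flip: power_mult)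
  \<comment> \<open>Squaring undoes the square root in \<open>torus_norm\<close> only for a
    nonnegative integral; the even exponent provides this.\<close>
  moreover have "cos_moment L (2 * n) \<ge> 0"
    unfolding cos_moment_def set_lebesgue_integral_def
    by (intro integral_nonneg_AE AE_I2) (simp add: power_mult)
  ultimately show ?thesis
    by (simp add: torus_norm_def cos_moment_def)
qed

text \<open>The exponential is \<open>cos + i * sin\<close>. Writing \<open>cos\<close> as
  \<open>(1 + cos) - 1\<close> turns the real part into a difference of consecutive moments, and the
  sine part integrates to zero.\<close>

lemma torus_inner_A_op_p_poly:
  fixes L :: "int ^ 'd"
  assumes "L \<noteq> 0"
  shows "torus_inner (A_op L (p_poly L n)) (p_poly L n) =
    of_real (cos_moment L (Suc (2 * n)) - cos_moment L (2 * n))"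
proof -
  let ?t = "\<lambda>x. 2 * pi * (real_vec L \<bullet> x)"
  have "A_op L (p_poly L n) x * cnj (p_poly L n x) =
     of_real ((1 + cos (?t x)) ^ Suc (2 * n) - (1 + cos (?t x)) ^ (2 * n))
       + \<i> * of_real (sin (?t x) * (1 + cos (?t x)) ^ (2 * n))" for x
  proof -
    have "exp (2 * complex_of_real pi * \<i> * complex_of_real (real_vec L \<bullet> x)) = cis (?t x)"
      by (simp add: cis_conv_exp mult_ac)
    also have "\<dots> = of_real (cos (?t x)) + \<i> * of_real (sin (?t x))"
      by (simp add: complex_eq_iff)
    finally have e: "exp (2 * complex_of_real pi * \<i> * complex_of_real (real_vec L \<bullet> x)) =
        of_real (cos (?t x)) + \<i> * of_real (sin (?t x))" .
    define q where "q = (1 + cos (?t x)) ^ n"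
    have q: "(1 + cos (?t x)) ^ (2 * n) = q * q" "(1 + cos (?t x)) ^ Suc (2 * n) = (1 + cos (?t x)) * (q * q)"
      by (simp_all only: q_def mult_2 power_add power_Suc)
    show ?thesis
      unfolding A_op_def p_poly_def e q q_def[symmetric] complex_cnj_complex_of_real
        of_real_add of_real_diff of_real_mult of_real_1
      by (simp only: algebra_simps mult_1_left)
  qed
  then have "torus_inner (A_op L (p_poly L n)) (p_poly L n) =
    (LINT x : cbox 0 1 | lborel.
       of_real ((1 + cos (?t x)) ^ Suc (2 * n) - (1 + cos (?t x)) ^ (2 * n))
       + \<i> * of_real (sin (?t x) * (1 + cos (?t x)) ^ (2 * n)))"
    by (simp add: torus_inner_def)
  also have "\<dots> = (LINT x : cbox 0 1 | lborel.
       complex_of_real ((1 + cos (?t x)) ^ Suc (2 * n) - (1 + cos (?t x)) ^ (2 * n)))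
       + (LINT x : cbox 0 1 | lborel. \<i> * of_real (sin (?t x) * (1 + cos (?t x)) ^ (2 * n)))"
    by (intro set_integral_add set_integrable_cube continuous_intros)
  also have "\<dots> = of_real (LINT x : cbox 0 1 | lborel.
       (1 + cos (?t x)) ^ Suc (2 * n) - (1 + cos (?t x)) ^ (2 * n))"
    by (simp only: set_integral_complex_of_real set_integral_mult_right LINT_sin_cos_power[OF assms]) simp
  also have "(LINT x : cbox 0 1 | lborel. (1 + cos (?t x)) ^ Suc (2 * n) - (1 + cos (?t x)) ^ (2 * n))
      = cos_moment L (Suc (2 * n)) - cos_moment L (2 * n)"
    unfolding cos_moment_def by (intro set_integral_diff set_integrable_cos_power)
  finally show ?thesis .
qed

text \<open>By the chain rule the \<open>j\<close>-th partial derivative is \<open>L $ j\<close>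
  times a common factor, so the weights \<open>L $ j\<close> in \<open>B_op\<close> produce the sum
  of squares.\<close>

lemma B_op_p_poly:
  fixes L :: "int ^ 'd"
  shows "B_op L (p_poly L n) x = - \<i> * of_real (n * (norm (real_vec L))\<^sup>2
    * (sin (2 * pi * (real_vec L \<bullet> x)) * (1 + cos (2 * pi * (real_vec L \<bullet> x))) ^ (n - 1)))"
proof -
  let ?t = "2 * pi * (real_vec L \<bullet> x)"
  define D where "D = n * (sin ?t * (1 + cos ?t) ^ (n - 1))"
  have pd: "partial_deriv j (p_poly L n) x = of_real (- (2 * pi * of_int (L $ j)) * D)" for j
  proof -
    have ax: "real_vec L \<bullet> axis j 1 = of_int (L $ j)"
      by (simp add: real_vec_def inner_axis)
    have "((\<lambda>s. (1 + cos (2 * pi * (real_vec L \<bullet> x + s * of_int (L $ j)))) ^ n) has_real_derivative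
        - (2 * pi * of_int (L $ j)) * D) (at 0)"
      unfolding D_def by (rule derivative_eq_intros refl | simp)+
    then have "((\<lambda>s. p_poly L n (x + s *\<^sub>R axis j 1)) has_vector_derivative
        of_real (- (2 * pi * of_int (L $ j)) * D)) (at 0)"
      unfolding p_poly_def inner_add_right inner_scaleR_right ax
      by (intro has_vector_derivative_of_real)
        (simp add: has_real_derivative_iff_has_vector_derivative)
    then show ?thesis
      unfolding partial_deriv_def by (rule vector_derivative_at)
  qed
  have "(norm (real_vec L))\<^sup>2 = (\<Sum>j\<in>UNIV. (of_int (L $ j))\<^sup>2)"
    by (simp only: power2_norm_eq_inner) (simp add: inner_vec_def real_vec_def power2_eq_square)
  then have "(\<Sum>j\<in>UNIV. of_int (L $ j) * of_real (- (2 * pi * of_int (L $ j)) * D)) =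
      complex_of_real (- (2 * pi * D * (norm (real_vec L))\<^sup>2))"
    by (simp add: sum_distrib_left sum_negf power2_eq_square mult_ac)
  then show ?thesis
    unfolding B_op_def pd by (simp add: D_def)
qed

lemma torus_inner_B_op_p_poly:
  fixes L :: "int ^ 'd"
  assumes "L \<noteq> 0" "n > 0"
  shows "torus_inner (B_op L (p_poly L n)) (p_poly L n) = 0"
proof -
  let ?t = "\<lambda>x. 2 * pi * (real_vec L \<bullet> x)"
  have "B_op L (p_poly L n) x * cnj (p_poly L n x) =
     - \<i> * of_real (n * (norm (real_vec L))\<^sup>2) * of_real (sin (?t x) * (1 + cos (?t x)) ^ (2 * n - 1))" for x
  proof -
    have "2 * n - 1 = n - 1 + n"
      using assms by simp
    then show ?thesis
      by (simp add: B_op_p_poly p_poly_def power_add)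
  qed
  then show ?thesis
    by (simp only: torus_inner_def set_integral_complex_of_real set_integral_mult_right
        LINT_sin_cos_power[OF assms(1)]) simp
qed

lemma torus_norm_B_op_p_poly:
  fixes L :: "int ^ 'd"
  assumes "n > 0"
  shows "(torus_norm (B_op L (p_poly L n)))\<^sup>2 =
    (real n)\<^sup>2 * norm (real_vec L) ^ 4 * (2 * cos_moment L (2 * n - 1) - cos_moment L (2 * n))"
proof -
  let ?c = "\<lambda>x. 1 + cos (2 * pi * (real_vec L \<bullet> x))"
  have "(cmod (B_op L (p_poly L n) x))\<^sup>2 =
     (real n)\<^sup>2 * norm (real_vec L) ^ 4 * (2 * ?c x ^ (2 * n - 1) - ?c x ^ (2 * n))" for x
  proof -
    obtain k where k: "n = Suc k"
      using assms gr0_implies_Suc by blast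
    \<comment> \<open>Since \<open>1 - cos\<close> is \<open>2 - ?c x\<close>, the squared modulus
      becomes a polynomial in \<open>?c x\<close> alone.\<close>
    have sc: "(sin (2 * pi * (real_vec L \<bullet> x)))\<^sup>2 = (2 - ?c x) * ?c x"
      using sin_cos_squared_add[of "2 * pi * (real_vec L \<bullet> x)"] by (simp add: power2_eq_square algebra_simps)
    have "(cmod (B_op L (p_poly L n) x))\<^sup>2 =
      (n * (norm (real_vec L))\<^sup>2 * (sin (2 * pi * (real_vec L \<bullet> x)) * ?c x ^ (n - 1)))\<^sup>2"
      unfolding B_op_p_poly norm_mult norm_of_real by (simp add: power_mult_distrib)
    also have "\<dots> = (real n)\<^sup>2 * norm (real_vec L) ^ 4 * (((2 - ?c x) * ?c x) * (?c x ^ k)\<^sup>2)"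
      unfolding power_mult_distrib sc by (simp add: k flip: power_mult)
    also have "((2 - ?c x) * ?c x) * (?c x ^ k)\<^sup>2 = 2 * ?c x ^ (2 * n - 1) - ?c x ^ (2 * n)"
    proof -
      have "2 * n = Suc (Suc (k * 2))" "2 * n - 1 = Suc (k * 2)"
        by (simp_all add: k)
      then show ?thesis
        by (simp only: power_Suc flip: power_mult) (simp only: algebra_simps)
    qed
    finally show ?thesis .
  qed
  moreover have "(torus_norm (B_op L (p_poly L n)))\<^sup>2 =
      (LINT x : cbox 0 1 | lborel. (cmod (B_op L (p_poly L n) x))\<^sup>2)"
    unfolding torus_norm_def set_lebesgue_integral_def
    by (intro real_sqrt_pow2 integral_nonneg_AE AE_I2) simp
  moreover have "(LINT x : cbox 0 1 | lborel. 2 * ?c x ^ (2 * n - 1) - ?c x ^ (2 * n)) =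
      2 * cos_moment L (2 * n - 1) - cos_moment L (2 * n)"
    unfolding cos_moment_def
    by (subst set_integral_diff) (auto intro!: set_integrable_mult_right set_integrable_cos_power)
  ultimately show ?thesis
    by simp
qed

section \<open>Exact value and asymptotics\<close>

lemma UP_torus_p_poly:
  fixes L :: "int ^ 'd"
  assumes L: "L \<noteq> 0" and n: "n > 0"
  shows "UP_torus L (p_poly L n) = 1 / 4 + 1 / (2 * (4 * real n - 1))"
proof -
  define I where "I = cos_moment L (2 * n)"
  define r where "r = real n"
  have r: "r \<ge> 1"
    using n by (simp add: r_def)
  have I: "I > 0"
    unfolding I_def by (rule cos_moment_pos[OF L])
  have "(2 * r + 1) * cos_moment L (Suc (2 * n)) = (4 * r + 1) * I"
    using cos_moment_Suc[OF L, of "2 * n"] by (simp add: I_def r_def)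
  \<comment> \<open>The recurrence at \<open>2 * n\<close> gives the ratio
    \<open>(4 * r + 1) / (2 * r + 1)\<close>; subtracting 1 leaves
    \<open>2 * r / (2 * r + 1)\<close>.\<close>
  then have up: "cos_moment L (Suc (2 * n)) - I = 2 * r / (2 * r + 1) * I"
    using r by (simp add: field_simps)
  have "2 * r * I = (4 * r - 1) * cos_moment L (2 * n - 1)"
    using cos_moment_Suc[OF L, of "2 * n - 1"] n by (simp add: I_def r_def of_nat_diff)
  \<comment> \<open>The recurrence at \<open>2 * n - 1\<close> gives the ratio
    \<open>2 * r / (4 * r - 1)\<close>; doubling it and subtracting 1 leaves
    \<open>1 / (4 * r - 1)\<close>.\<close>
  then have down: "2 * cos_moment L (2 * n - 1) - I = I / (4 * r - 1)"
    using r by (simp add: field_simps)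
  have N: "norm (real_vec L) \<noteq> 0"
    using L by (auto simp: real_vec_def vec_eq_iff)
  have n4: "torus_norm (p_poly L n) ^ 4 = I\<^sup>2"
    by (simp add: I_def flip: torus_norm_p_poly power_mult)
  have "UP_torus L (p_poly L n) = 1 / norm (real_vec L) ^ 4 * (I\<^sup>2 / (2 * r / (2 * r + 1) * I)\<^sup>2 - 1) *
      (r\<^sup>2 * norm (real_vec L) ^ 4 * (I / (4 * r - 1)) / I)"
    unfolding UP_torus_def n4 torus_norm_B_op_p_poly[OF n] torus_norm_p_poly
      torus_inner_A_op_p_poly[OF L] torus_inner_B_op_p_poly[OF L n] norm_of_real power2_abs
    by (simp only: up down flip: I_def r_def) simp
  also have "\<dots> = (((2 * r + 1) / (2 * r))\<^sup>2 - 1) * (r\<^sup>2 / (4 * r - 1))"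
    using I N by (simp add: power_mult_distrib power_divide)
  \<comment> \<open>The first factor is \<open>(4 * r + 1) / (4 * r^2)\<close>, so the product is
    \<open>(4 * r + 1) / (4 * (4 * r - 1))\<close>.\<close>
  also have "\<dots> = 1 / 4 + 1 / (2 * (4 * r - 1))"
    using r by (simp add: field_simps power2_eq_square)
  finally show ?thesis
    by (simp add: r_def)
qed

theorem lemma2:
  fixes L :: "int ^ 'd"
  assumes "L \<noteq> 0"
  shows "(\<lambda>n. UP_torus L (p_poly L n) - 1 / 4) \<in> O(\<lambda>n. 1 / real n)"
proof (rule bigoI[where c = 1])
  \<comment> \<open>For \<open>n > 0\<close> the error is exactly
    \<open>1 / (2 * (4 * n - 1))\<close>, and \<open>8 * n - 2\<close> is at least \<open>n\<close>,
    so the constant 1 suffices.\<close>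
  show "eventually (\<lambda>n. norm (UP_torus L (p_poly L n) - 1 / 4) \<le> 1 * norm (1 / real n)) sequentially"
    using eventually_gt_at_top[of 0]
    by eventually_elim (simp add: UP_torus_p_poly[OF assms] field_simps)
qed

end
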